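(* Let $\mathcal A=\mathbb{C}A_n/I_D$ for a Dyck path $D$ of length $n$, and let $X\in\mathcal I_{\mathcal A}$. Let $U_{\mathcal A}(X)$ be the subvariety of $U_{\mathcal A}$ given by $u_X=0$. Then $U_{\mathcal A}(X)$ is isomorphic to $U_{\mathcal A'}\times U_{\mathcal A''}$, where $\mathcal A'$ and $\mathcal A''$ are linear Nakayama algebras of lower rank (i.e. of the form $\mathbb{C}A_m/J$ with $m<n$). Concretely: - if $X=(i,j)$ is a diamond, then $\mathcal A'=\mathbb{C}A_{j-i-1}$ and $\mathcal A''=\mathbb{C}A_{n+i-j}/I_{D_{ij}}$; - if $X=(i)$ or $X=(\Sigma i)$, then $\mathcal A'=\mathbb{C}A_{n-i}/I_{D_R}$ and $\mathcal A''=\mathbb{C}A_{i-1}/I_{D_L}$, where $D_{ij}$, $D_R$, $D_L$ are the Dyck paths (of lengths $n+i-j$, $n-i$, $i-1$ respectively) obtained from $D$ as described in the context.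
   Context: **Dyck paths and algebras.** A Dyck path $D$ of length $n$ is a lattice path from $(1,0)$ to $(n+1,n)$ with up steps $(i,j)\to(i,j+1)$ and down steps $(i,j)\to(i+1,j)$, all of whose vertices satisfy $j\ge i-1$. Its up steps are labelled in order $(1),\dots,(n)$ and its down steps in order $(\Sigma 1),\dots,(\Sigma n)$; the down step $(\Sigma i)$ goes from $(i,k_i)$ to $(i+1,k_i)$. A point $(i,j)$, $1\le i\le j\le n$, is on or below $D$ iff $j\le k_i$. $\mathbb{C}A_n$ is the path algebra of $1\leftarrow2\leftarrow\cdots\leftarrow n$ with arrows $\alpha_i:i+1\to i$. $I_D$ is the two-sided ideal generated by the paths $\alpha_b\alpha_{b-1}\cdots\alpha_{a-1}$ (from $b+1$ to $a-1$) for all valleys $(a,b)$ of $D$ (vertices preceded by a down step and followed by an up step). The algebras $\mathbb{C}A_n/I_D$ are the linear Nakayama algebras. The full path algebra $\mathbb{C}A_m$ corresponds to the Dyck path with $m$ up steps followed by $m$ down steps. For rank $0$, $U_{\mathbb{C}A_0}$ is a point. **Index set.** For $\mathcal A=\mathbb{C}A_n/I_D$, $\mathcal I_{\mathcal A}$ consists of the $2n$ steps $(i),(\Sigma i)$ of $D$ together with the diamonds below $D$: a diamond is labelled by its top corner $(i,j)$, $1\le i<j\le n$ (its other corners are $(i,j-1),(i+1,j),(i+1,j-1)$), and it is below $D$ iff $(i,j)$ is on or below $D$. **Compatibility** of $X,Y\in\mathcal I_{\mathcal A}$: (a) $(i,j)$ and $(k,l)$ are compatible iff the intervals $[i,j],[k,l]$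 are comparable under inclusion or disjoint; (b) $(i,j)$ and $(k)$ are compatible iff $k<i$ or $j\le k$; (c) $(i,j)$ and $(\Sigma k)$ are compatible iff $k\le i$ or $j<k$; (d) $(i)$ and $(\Sigma j)$ are compatible iff $i<j$ or the down step $(\Sigma j)$ comes before the up step $(i)$ in $D$; (e) two up steps are always compatible, and two down steps are always compatible. **Configuration space.** $U_{\mathcal A}\subset\mathbb{C}^{\mathcal I_{\mathcal A}}$ is the affine variety cut out by $u_X+\prod_{Y\text{ incompatible with }X}u_Y=1$ for all $X\in\mathcal I_{\mathcal A}$. **The smaller Dyck paths** (obtained from $D$ by contracting the region of the grid incompatible with $X$). Regard $D$ as a word in its up and down steps. $D_{ij}$ is the Dyck path obtained by deleting from $D$ the steps incompatible with $(i,j)$, i.e. the up steps $(i),\dots,(j-1)$ and the down steps $(\Sigma(i+1)),\dots,(\Sigma j)$. $D_L$ is the subword of $D$ consisting of the up steps $(1),\dots,(i-1)$ and the down steps $(\Sigma1),\dots,(\Sigma(i-1))$. $D_R$ is the subword consisting of the up steps $(i+1),\dots,(n)$ and the down steps $(\Sigma(i+1)),\dots,(\Sigma n)$. (In each case the resulting word is placed in the grid of the appropriate size.) *)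

theory Defs
  imports Complex_Main "HOL-Library.FuncSet"
begin

section \<open>Dyck paths\<close>

text \<open>A lattice path starting at (1,0) is given by its word of steps: an up step goes from (i,j)
  to (i,j+1), a down step from (i,j) to (i+1,j).\<close>

datatype step = UpStep | DownStep

text \<open>The lattice point reached after the first m steps.\<close>

definition vertex :: "step list \<Rightarrow> nat \<Rightarrow> nat \<times> nat" where
  "vertex D m = (1 + count_list (take m D) DownStep, count_list (take m D) UpStep)"

text \<open>The last clause is the inequality j \<open>\<ge>\<close> i - 1, written without truncated subtraction.\<close>

definition dyck_path :: "nat \<Rightarrow> step list \<Rightarrow> bool" where
  "dyck_path n D \<longleftrightarrow>
     vertex D (length D) = (n + 1, n) \<and>
     (\<forall>m \<le> length D. fst (vertex D m) \<le> snd (vertex D m) + 1)"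

definition full_path :: "nat \<Rightarrow> step list" where
  "full_path m = replicate m UpStep @ replicate m DownStep"

text \<open>The position in the word (counted from 0) of the k-th step of kind s; here k counts from 1,
  and the value is only meaningful if D has at least k such steps.\<close>

definition step_pos :: "step list \<Rightarrow> step \<Rightarrow> nat \<Rightarrow> nat" where
  "step_pos D s k = filter (\<lambda>m. D ! m = s) [0..<length D] ! (k - 1)"

text \<open>The i-th down step runs from (i, k) to (i+1, k) with k = \<open>down_height D i\<close>.\<close>

definition down_height :: "step list \<Rightarrow> nat \<Rightarrow> nat" where
  "down_height D i = snd (vertex D (step_pos D DownStep i))"

definition on_or_below :: "nat \<Rightarrow> step list \<Rightarrow> nat \<Rightarrow> nat \<Rightarrow> bool" where
  "on_or_below n D i j \<longleftrightarrow> 1 \<le> i \<and> i \<le> j \<and> j \<le> n \<and> j \<le> down_height D i"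


section \<open>Index set and compatibility\<close>

text \<open>The linear Nakayama algebra of rank n attached to a Dyck path D of length n, that is, the
  quotient of the path algebra of the linear quiver by the ideal generated by the paths of the
  valleys of D, is represented by the pair n, D: index set, compatibility and configuration space
  are defined in terms of the path. The full path algebra of rank m is \<open>full_path m\<close>.

  \<open>Up i\<close>, \<open>Down i\<close> and \<open>Diamond i j\<close> are the up step (i), the down step (\<open>\<Sigma>\<close>i) and the diamond with
  top corner (i,j).\<close>

datatype index = Up nat | Down nat | Diamond nat nat

definition index_set :: "nat \<Rightarrow> step list \<Rightarrow> index set" where
  "index_set n D =
     Up ` {1..n} \<union> Down ` {1..n} \<union> {Diamond i j | i j. i < j \<and> on_or_below n D i j}"

fun compatible :: "step list \<Rightarrow> index \<Rightarrow> index \<Rightarrow> bool" where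
  "compatible D (Diamond i j) (Diamond k l) \<longleftrightarrow>
     {i..j} \<subseteq> {k..l} \<or> {k..l} \<subseteq> {i..j} \<or> {i..j} \<inter> {k..l} = {}"
| "compatible D (Diamond i j) (Up k) \<longleftrightarrow> k < i \<or> j \<le> k"
| "compatible D (Up k) (Diamond i j) \<longleftrightarrow> k < i \<or> j \<le> k"
| "compatible D (Diamond i j) (Down k) \<longleftrightarrow> k \<le> i \<or> j < k"
| "compatible D (Down k) (Diamond i j) \<longleftrightarrow> k \<le> i \<or> j < k"
| "compatible D (Up i) (Down j) \<longleftrightarrow> i < j \<or> step_pos D DownStep j < step_pos D UpStep i"
| "compatible D (Down j) (Up i) \<longleftrightarrow> i < j \<or> step_pos D DownStep j < step_pos D UpStep i"
| "compatible D (Up i) (Up j) \<longleftrightarrow> True"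
| "compatible D (Down i) (Down j) \<longleftrightarrow> True"


section \<open>Affine varieties\<close>

text \<open>A point of the affine space of a coordinate set I is a function in \<open>extensional I\<close>, so that
  it is determined by its values on I; for I empty there is exactly one point.\<close>

inductive_set poly_fun :: "'a set \<Rightarrow> (('a \<Rightarrow> complex) \<Rightarrow> complex) set" for I :: "'a set" where
  const: "(\<lambda>u. c) \<in> poly_fun I"
| coord: "x \<in> I \<Longrightarrow> (\<lambda>u. u x) \<in> poly_fun I"
| add: "p \<in> poly_fun I \<Longrightarrow> q \<in> poly_fun I \<Longrightarrow> (\<lambda>u. p u + q u) \<in> poly_fun I"
| mult: "p \<in> poly_fun I \<Longrightarrow> q \<in> poly_fun I \<Longrightarrow> (\<lambda>u. p u * q u) \<in> poly_fun I"

text \<open>Morphisms and isomorphisms of closed subvarieties V, W of the affine spaces of I, J.\<close>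

definition regular_map ::
  "'a set \<Rightarrow> ('a \<Rightarrow> complex) set \<Rightarrow> 'b set \<Rightarrow> ('b \<Rightarrow> complex) set \<Rightarrow>
   (('a \<Rightarrow> complex) \<Rightarrow> 'b \<Rightarrow> complex) \<Rightarrow> bool" where
  "regular_map I V J W f \<longleftrightarrow>
     f \<in> V \<rightarrow> W \<and> (\<forall>y\<in>J. \<exists>p\<in>poly_fun I. \<forall>u\<in>V. f u y = p u)"

definition variety_iso ::
  "'a set \<Rightarrow> ('a \<Rightarrow> complex) set \<Rightarrow> 'b set \<Rightarrow> ('b \<Rightarrow> complex) set \<Rightarrow> bool" where
  "variety_iso I V J W \<longleftrightarrow>
     (\<exists>f g. regular_map I V J W f \<and> regular_map J W I V g \<and>
            (\<forall>u\<in>V. g (f u) = u) \<and> (\<forall>w\<in>W. f (g w) = w))"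

text \<open>The product of V and W, a subset of the affine space of the coordinate set \<open>I <+> J\<close>.\<close>

definition variety_prod ::
  "('a \<Rightarrow> complex) set \<Rightarrow> ('b \<Rightarrow> complex) set \<Rightarrow> ('a + 'b \<Rightarrow> complex) set" where
  "variety_prod V W = {case_sum u v | u v. u \<in> V \<and> v \<in> W}"


section \<open>Configuration spaces\<close>

definition config_space :: "nat \<Rightarrow> step list \<Rightarrow> (index \<Rightarrow> complex) set" where
  "config_space n D =
     {u \<in> extensional (index_set n D).
        \<forall>X\<in>index_set n D. u X + (\<Prod>Y\<in>{Y \<in> index_set n D. \<not> compatible D X Y}. u Y) = 1}"

definition config_stratum :: "nat \<Rightarrow> step list \<Rightarrow> index \<Rightarrow> (index \<Rightarrow> complex) set" where
  "config_stratum n D X = {u \<in> config_space n D. u X = 0}"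


section \<open>The smaller Dyck paths\<close>

definition path_diamond :: "step list \<Rightarrow> nat \<Rightarrow> nat \<Rightarrow> step list" where
  "path_diamond D i j =
     nths D (- (step_pos D UpStep ` {i..<j} \<union> step_pos D DownStep ` {i+1..j}))"

definition path_left :: "step list \<Rightarrow> nat \<Rightarrow> step list" where
  "path_left D i = nths D (step_pos D UpStep ` {1..<i} \<union> step_pos D DownStep ` {1..<i})"

definition path_right :: "nat \<Rightarrow> step list \<Rightarrow> nat \<Rightarrow> step list" where
  "path_right n D i = nths D (step_pos D UpStep ` {i+1..n} \<union> step_pos D DownStep ` {i+1..n})"

end

theory Submission
  imports Defs
begin

text \<open>On the stratum \<open>u X = 0\<close> every index Y incompatible with X has \<open>u Y = 1\<close>, because the
  product in the equation of Y contains the vanishing factor \<open>u X\<close>. The factors \<open>u Y\<close> drop out of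
  the remaining equations, so the stratum is the variety of the same kind of equations on the link of X:
  the indices different from X and compatible with it (\<open>u_variety_stratum_iso\<close>). If the link is
  a disjoint union of two parts such that everything in one part is compatible with everything in
  the other, then no equation mixes the two parts, and the variety of the link is a product
  (\<open>variety_prod_u_variety\<close>). It remains to identify the link of X, with its compatibility
  relation, with the disjoint union of the index sets of two smaller Dyck paths
  (\<open>stratum_iso_prodI\<close>).

  The picture behind the identifications is that indices are intervals: the diamond (i,j) is [i,j],
  the up step (k) is the prefix [0,k] and the down step (\<open>\<Sigma>\<close>k) the suffix [k,n+1] of [0,n+1].
  Two indices are compatible iff their intervals are nested or disjoint, except that a down step
  and an up step whose intervals cross are also compatible when the down step comes first in D.

  For a diamond (i,j), the intervals inside [i,j] form a copy of the index set of a full path, in which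
  the prefixes and suffixes of [i,j] are the up and down steps; the intervals that contain [i,j] or
  are disjoint from it are the intervals after contraction of [i,j] to a point
  (\<open>stratum_Diamond\<close>). For a step, the link consists of the indices to the left and those to the
  right of i. If X is the up step (i) and k < i, then the down step (\<open>\<Sigma>\<close>k) is compatible with X iff it
  precedes X, and the diamond (k,i) lies below D iff it does not; so exactly one of the two belongs to
  the link, and it serves as the k-th down step of the left path (\<open>stratum_Up\<close>). The case of a
  down step is dual (\<open>stratum_Down\<close>).

  Everything about a Dyck path enters through the comparison of up step labels a with the heights of
  the down steps k, that is, whether (a) comes before (\<open>\<Sigma>\<close>k): this comparison decides which diamonds
  lie below the path and when an up and a down step are compatible. For a subword it is inherited
  from the larger path along the increasing relabelling of the steps that are kept
  (\<open>le_down_height_subword_iff\<close>).\<close>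


section \<open>Steps of a lattice path and the heights of its down steps\<close>

lemma step_pos_snoc:
  "step_pos (xs @ [x]) s k =
     (if k - 1 < length (filter (\<lambda>m. xs ! m = s) [0..<length xs]) then step_pos xs s k
      else (if x = s then [length xs] else []) ! (k - 1 - length (filter (\<lambda>m. xs ! m = s) [0..<length xs])))"
proof -
  have "filter (\<lambda>m. (xs @ [x]) ! m = s) [0..<length xs] = filter (\<lambda>m. xs ! m = s) [0..<length xs]"
    by (rule filter_cong) (auto simp: nth_append)
  then show ?thesis by (simp add: step_pos_def nth_append)
qed

lemma length_filter_positions:
  "length (filter (\<lambda>m. xs ! m = s) [0..<length xs]) = count_list xs s"
proof (induction xs rule: rev_induct)
  case (snoc x xs)
  have "filter (\<lambda>m. (xs @ [x]) ! m = s) [0..<length xs] = filter (\<lambda>m. xs ! m = s) [0..<length xs]"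
    by (rule filter_cong) (auto simp: nth_append)
  with snoc show ?case by simp
qed simp

text \<open>The basic tool for positions: it turns the position of the k-th step into a condition on the
  number of such steps in a prefix, and prefixes behave well under concatenation and subwords.\<close>

lemma step_pos_less_iff:
  assumes "1 \<le> k" "k \<le> count_list xs s" "q \<le> length xs"
  shows "step_pos xs s k < q \<longleftrightarrow> k \<le> count_list (take q xs) s"
  using assms
proof (induction xs arbitrary: q rule: rev_induct)
  case (snoc x xs)
  show ?case
  proof (cases "k \<le> count_list xs s")
    case True
    have less: "step_pos xs s k < length xs" using snoc.IH[of "length xs"] True snoc.prems by simp
    then show ?thesis
      using snoc True less less_SucI[OF less] by (cases "q \<le> length xs") (auto simp: step_pos_snoc length_filter_positions le_Suc_eq)
  next
    case False
    then have "k = Suc (count_list xs s)" "x = s" using snoc.prems by (auto split: if_splits)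
    moreover have "count_list (take q xs) s \<le> count_list xs s"
      by (metis append_take_drop_id count_list_append le_add1)
    ultimately show ?thesis
      using snoc.prems by (cases "q \<le> length xs") (auto simp: step_pos_snoc length_filter_positions le_Suc_eq)
  qed
qed simp

lemma count_list_take_Suc:
  "q < length xs \<Longrightarrow> count_list (take (Suc q) xs) s = count_list (take q xs) s + (if xs ! q = s then 1 else 0)"
  by (simp add: take_Suc_conv_app_nth)

lemma count_list_take_le: "count_list (take q xs) s \<le> count_list xs s"
  by (metis append_take_drop_id count_list_append le_add1)

lemma step_pos_eqI:
  assumes "q < length xs" "xs ! q = s" "k = Suc (count_list (take q xs) s)"
  shows "step_pos xs s k = q"
proof -
  have k: "count_list (take (Suc q) xs) s = k" using assms by (simp add: count_list_take_Suc)
  then have "k \<le> count_list xs s" using count_list_take_le by metis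
  then show ?thesis
    using step_pos_less_iff[of k xs s q] step_pos_less_iff[of k xs s "Suc q"] k assms by auto
qed

lemma step_pos_props:
  assumes "1 \<le> k" "k \<le> count_list xs s"
  shows "step_pos xs s k < length xs" "xs ! step_pos xs s k = s"
    "count_list (take (step_pos xs s k) xs) s = k - 1"
proof -
  let ?p = "step_pos xs s k"
  show p: "?p < length xs" using step_pos_less_iff[OF assms, of "length xs"] assms by simp
  have "k \<le> count_list (take (Suc ?p) xs) s" "\<not> k \<le> count_list (take ?p xs) s"
    using step_pos_less_iff[OF assms, of "Suc ?p"] step_pos_less_iff[OF assms, of ?p] p by auto
  then show "xs ! ?p = s" "count_list (take ?p xs) s = k - 1"
    using p by (auto simp: count_list_take_Suc split: if_splits)
qed

lemma inj_on_step_pos: "inj_on (step_pos xs s) {1..count_list xs s}"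
  by (rule inj_onI) (metis One_nat_def Suc_pred' atLeastAtMost_iff le_eq_less_or_eq less_eq_Suc_le step_pos_props(3))

lemma down_height_eq: "down_height D k = count_list (take (step_pos D DownStep k) D) UpStep"
  by (simp add: down_height_def vertex_def)

text \<open>The inequality at the vertices is critical only right after a down step, since up steps
  improve it; after the k-th down step it says that this step has height at least k.\<close>

lemma dyck_path_iff:
  "dyck_path n D \<longleftrightarrow> count_list D UpStep = n \<and> count_list D DownStep = n \<and>
     (\<forall>k\<in>{1..n}. k \<le> down_height D k)"
proof (intro iffI conjI ballI)
  assume *: "dyck_path n D"
  then show c: "count_list D UpStep = n" "count_list D DownStep = n"
    by (auto simp: dyck_path_def vertex_def)
  fix k assume k: "k \<in> {1..n}"
  let ?p = "step_pos D DownStep k"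
  have p: "?p < length D" "D ! ?p = DownStep" "count_list (take ?p D) DownStep = k - 1"
    using step_pos_props[of k D DownStep] k c by auto
  have "fst (vertex D (Suc ?p)) \<le> snd (vertex D (Suc ?p)) + 1"
    using * p(1) by (auto simp: dyck_path_def)
  then show "k \<le> down_height D k"
    using p k by (simp add: vertex_def count_list_take_Suc down_height_eq)
next
  assume *: "count_list D UpStep = n \<and> count_list D DownStep = n \<and> (\<forall>k\<in>{1..n}. k \<le> down_height D k)"
  have "count_list (take m D) DownStep \<le> count_list (take m D) UpStep" if m: "m \<le> length D" for m
  proof (cases "count_list (take m D) DownStep = 0")
    case False
    let ?k = "count_list (take m D) DownStep"
    have k: "1 \<le> ?k" "?k \<le> count_list D DownStep" using False count_list_take_le by auto
    let ?p = "step_pos D DownStep ?k"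
    have "?p < m" using step_pos_less_iff[OF k m] by simp
    then have "take ?p D = take ?p (take m D)" by (simp add: min_def)
    then have "down_height D ?k \<le> count_list (take m D) UpStep"
      unfolding down_height_eq by (metis count_list_take_le)
    moreover have "?k \<le> down_height D ?k" using * k by simp
    ultimately show ?thesis by linarith
  qed simp
  then show "dyck_path n D" using * by (auto simp: dyck_path_def vertex_def)
qed

lemma step_pos_Up_less_Down_iff:
  assumes "dyck_path n D" "a \<in> {1..n}" "b \<in> {1..n}"
  shows "step_pos D UpStep a < step_pos D DownStep b \<longleftrightarrow> a \<le> down_height D b"
  using assms step_pos_less_iff[of a D UpStep "step_pos D DownStep b"] step_pos_props(1)[of b D DownStep]
  by (auto simp: dyck_path_iff down_height_eq)

lemma step_pos_Down_less_Up_iff: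
  assumes "dyck_path n D" "a \<in> {1..n}" "b \<in> {1..n}"
  shows "step_pos D DownStep b < step_pos D UpStep a \<longleftrightarrow> down_height D b < a"
proof -
  have "step_pos D UpStep a \<noteq> step_pos D DownStep b"
    using assms step_pos_props(2)[of a D UpStep] step_pos_props(2)[of b D DownStep]
    by (auto simp: dyck_path_iff)
  then show ?thesis using step_pos_Up_less_Down_iff[OF assms] by linarith
qed

lemma down_height_mono:
  assumes "dyck_path n D" "b \<in> {1..n}" "c \<in> {1..n}" "b \<le> c"
  shows "down_height D b \<le> down_height D c"
proof -
  have "step_pos D DownStep b \<le> step_pos D DownStep c"
    using assms step_pos_less_iff[of c D DownStep "step_pos D DownStep b"]
      step_pos_props(1,3)[of b D DownStep]
    by (fastforce simp: dyck_path_iff)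
  then have "take (step_pos D DownStep b) D = take (step_pos D DownStep b) (take (step_pos D DownStep c) D)"
    by (simp add: min_def)
  then show ?thesis unfolding down_height_eq by (metis count_list_take_le)
qed

lemma down_height_full_path:
  assumes "k \<in> {1..m}"
  shows "down_height (full_path m) k = m"
proof -
  have c: "count_list (replicate k x) y = (if x = y then k else 0)" for k and x y :: step
    by (induction k) auto
  have "step_pos (full_path m) DownStep k = m + (k - 1)"
    using assms by (intro step_pos_eqI) (auto simp: full_path_def nth_append c)
  then show ?thesis by (simp add: down_height_eq full_path_def c)
qed

lemma dyck_path_full_path: "dyck_path m (full_path m)"
proof -
  have c: "count_list (replicate k x) y = (if x = y then k else 0)" for k and x y :: step
    by (induction k) auto
  show ?thesis by (auto simp: dyck_path_iff down_height_full_path) (auto simp: full_path_def c)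
qed


section \<open>Subwords of a Dyck path\<close>

lemma count_list_nths:
  "count_list (nths xs K) s = card {p \<in> K. p < length xs \<and> xs ! p = s}"
proof (induction xs rule: rev_induct)
  case (snoc x xs)
  have "{p \<in> K. p < length (xs @ [x]) \<and> (xs @ [x]) ! p = s} =
    {p \<in> K. p < length xs \<and> xs ! p = s} \<union> (if length xs \<in> K \<and> x = s then {length xs} else {})"
    by (auto simp: nth_append less_Suc_eq)
  then show ?case using snoc by (simp add: nths_append)
qed simp

text \<open>The sublevel sets of an increasing function are initial segments, which are determined by their
  cardinality.\<close>

lemma le_card_strict_mono_on_iff:
  fixes g :: "nat \<Rightarrow> nat"
  assumes "strict_mono_on {1..m} g" "a \<in> {1..m}"
  shows "a \<le> card {c \<in> {1..m}. g c \<le> t} \<longleftrightarrow> g a \<le> t"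
proof
  assume "g a \<le> t"
  then have "{1..a} \<subseteq> {c \<in> {1..m}. g c \<le> t}"
    using assms strict_mono_on_leD[OF assms(1)] by fastforce
  from card_mono[OF _ this] show "a \<le> card {c \<in> {1..m}. g c \<le> t}" by simp
next
  assume a: "a \<le> card {c \<in> {1..m}. g c \<le> t}"
  show "g a \<le> t"
  proof (rule ccontr)
    assume "\<not> g a \<le> t"
    then have "{c \<in> {1..m}. g c \<le> t} \<subseteq> {1..<a}"
      using assms strict_mono_on_leD[OF assms(1), of a] by force
    from card_mono[OF _ this] have "card {c \<in> {1..m}. g c \<le> t} \<le> a - 1" by simp
    then show False using a assms(2) unfolding atLeastAtMost_iff by linarith
  qed
qed

context
  \<comment> \<open>E keeps the up steps g(1) < ... < g(m) and the down steps f(1) < ... < f(m) of D\<close>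
  fixes n m :: nat and D E :: "step list" and f g :: "nat \<Rightarrow> nat"
  assumes D: "dyck_path n D"
    and f: "strict_mono_on {1..m} f" "f ` {1..m} \<subseteq> {1..n}"
    and g: "strict_mono_on {1..m} g" "g ` {1..m} \<subseteq> {1..n}"
    and E: "E = nths D (step_pos D UpStep ` g ` {1..m} \<union> step_pos D DownStep ` f ` {1..m})"
begin

lemma count_list_subword:
  assumes q: "q \<le> length D"
  defines "K \<equiv> step_pos D UpStep ` g ` {1..m} \<union> step_pos D DownStep ` f ` {1..m}"
  shows "count_list (nths (take q D) K) UpStep = card {a \<in> {1..m}. g a \<le> count_list (take q D) UpStep}"
    and "count_list (nths (take q D) K) DownStep = card {b \<in> {1..m}. f b \<le> count_list (take q D) DownStep}"
proof -
  have c: "count_list D s = n" for s using D by (cases s) (auto simp: dyck_path_iff)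
  have main: "card {p \<in> K. p < length (take q D) \<and> take q D ! p = s}
      = card {a \<in> {1..m}. r a \<le> count_list (take q D) s}"
    if r: "strict_mono_on {1..m} r" "r ` {1..m} \<subseteq> {1..n}"
      and K: "{p \<in> K. D ! p = s} = step_pos D s ` r ` {1..m}" for r s
  proof -
    have "{p \<in> K. p < length (take q D) \<and> take q D ! p = s} = {p \<in> K. D ! p = s} \<inter> {p. p < q}"
      using q by auto
    also have "\<dots> = (\<lambda>a. step_pos D s (r a)) ` {a \<in> {1..m}. step_pos D s (r a) < q}"
      unfolding K by auto
    also have "{a \<in> {1..m}. step_pos D s (r a) < q} = {a \<in> {1..m}. r a \<le> count_list (take q D) s}"
      using step_pos_less_iff[of _ D s q] r(2) q c by force
    finally have *: "{p \<in> K. p < length (take q D) \<and> take q D ! p = s} =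
        (\<lambda>a. step_pos D s (r a)) ` {a \<in> {1..m}. r a \<le> count_list (take q D) s}" .
    have "inj_on (step_pos D s \<circ> r) {1..m}"
      using strict_mono_on_imp_inj_on[OF r(1)] inj_on_subset[OF inj_on_step_pos[of D s]] r(2) c
      by (intro comp_inj_on) auto
    then have "inj_on (\<lambda>a. step_pos D s (r a)) {a \<in> {1..m}. r a \<le> count_list (take q D) s}"
      unfolding comp_def by (rule inj_on_subset) auto
    then show ?thesis unfolding * by (rule card_image)
  qed
  have nth: "D ! step_pos D s a = s" if "a \<in> {1..n}" for s a
    using step_pos_props(2)[of a D s] that c by auto
  have "\<forall>p \<in> step_pos D UpStep ` g ` {1..m}. D ! p = UpStep"
    "\<forall>p \<in> step_pos D DownStep ` f ` {1..m}. D ! p = DownStep"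
    using nth f(2) g(2) by blast+
  moreover have "{p \<in> A \<union> B. P p} = A" "{p \<in> B \<union> A. P p} = A"
    if "\<forall>p\<in>A. P p" "\<forall>p\<in>B. \<not> P p" for A B :: "nat set" and P
    using that by auto
  ultimately have K_eq: "{p \<in> K. D ! p = UpStep} = step_pos D UpStep ` g ` {1..m}"
    "{p \<in> K. D ! p = DownStep} = step_pos D DownStep ` f ` {1..m}"
    unfolding K_def by simp_all
  show "count_list (nths (take q D) K) UpStep = card {a \<in> {1..m}. g a \<le> count_list (take q D) UpStep}"
    unfolding count_list_nths by (rule main[OF g K_eq(1)])
  show "count_list (nths (take q D) K) DownStep = card {b \<in> {1..m}. f b \<le> count_list (take q D) DownStep}"
    unfolding count_list_nths by (rule main[OF f K_eq(2)])
qed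

text \<open>A subword keeps the order of its letters, so the a-th up step of E precedes its k-th down step iff
  the corresponding steps g(a) and f(k) of D are in this order.\<close>

lemma le_down_height_subword_iff:
  assumes a: "a \<in> {1..m}" and k: "k \<in> {1..m}"
  shows "a \<le> down_height E k \<longleftrightarrow> g a \<le> down_height D (f k)"
proof -
  let ?K = "step_pos D UpStep ` g ` {1..m} \<union> step_pos D DownStep ` f ` {1..m}"
  let ?q = "step_pos D DownStep (f k)"
  have "f k \<in> {1..n}" using f(2) k by blast
  then have fk: "1 \<le> f k" "f k \<le> count_list D DownStep" using D by (auto simp: dyck_path_iff)
  note q = step_pos_props[OF fk]
  \<comment> \<open>the position in E of the down step f(k) of D\<close>
  let ?r = "length (nths (take ?q D) ?K)"
  have "D = take ?q D @ D ! ?q # drop (Suc ?q) D"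
    using q(1) by (simp add: id_take_nth_drop)
  then have "E = nths (take ?q D @ D ! ?q # drop (Suc ?q) D) ?K" using E by simp
  then have E': "E = nths (take ?q D) ?K @ DownStep # nths (drop (Suc ?q) D) {j. Suc j + ?q \<in> ?K}"
    using q k by (simp add: nths_append nths_Cons min_def)
  have "f b \<le> f k - 1 \<longleftrightarrow> b < k" if "b \<in> {1..m}" for b
    using strict_mono_on_less[OF f(1) that k] fk by linarith
  then have "{b \<in> {1..m}. f b \<le> f k - 1} = {1..<k}" using k by auto
  then have "count_list (nths (take ?q D) ?K) DownStep = k - 1"
    using count_list_subword(2)[of ?q] q by simp
  then have "step_pos E DownStep k = ?r"
    using k by (intro step_pos_eqI) (simp_all add: E')
  then have "down_height E k = count_list (nths (take ?q D) ?K) UpStep"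
    by (simp add: down_height_eq E')
  also have "\<dots> = card {a \<in> {1..m}. g a \<le> down_height D (f k)}"
    using count_list_subword(1)[of ?q] q by (simp add: down_height_eq)
  finally show ?thesis using le_card_strict_mono_on_iff[OF g(1) a] by simp
qed

lemma dyck_path_subword:
  assumes "\<And>k. k \<in> {1..m} \<Longrightarrow> g k \<le> down_height D (f k)"
  shows "dyck_path m E"
proof -
  have "{a \<in> {1..m}. g a \<le> n} = {1..m}" "{a \<in> {1..m}. f a \<le> n} = {1..m}" using f(2) g(2) by auto
  then have "count_list E UpStep = m" "count_list E DownStep = m"
    using count_list_subword[of "length D"] D by (simp_all add: E dyck_path_iff)
  then show ?thesis using assms le_down_height_subword_iff by (auto simp: dyck_path_iff)
qed

end

lemma nths_cong_positions:
  assumes "\<And>p. p < length xs \<Longrightarrow> p \<in> A \<longleftrightarrow> p \<in> B"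
  shows "nths xs A = nths xs B"
  unfolding nths_def
  by (rule arg_cong[where f = "map fst"], rule filter_cong) (use assms in \<open>auto dest: set_zip_rightD\<close>)

text \<open>Deleting steps is keeping the others, because every position carries exactly one labelled step.\<close>

lemma nths_Compl_steps:
  assumes D: "dyck_path n D" and A: "A \<subseteq> {1..n}" and B: "B \<subseteq> {1..n}"
  shows "nths D (- (step_pos D UpStep ` A \<union> step_pos D DownStep ` B)) =
    nths D (step_pos D UpStep ` ({1..n} - A) \<union> step_pos D DownStep ` ({1..n} - B))"
proof (rule nths_cong_positions)
  fix p assume p: "p < length D"
  let ?k = "Suc (count_list (take p D) (D ! p))"
  have c: "count_list D s = n" for s using D by (cases s) (auto simp: dyck_path_iff)
  have k: "step_pos D (D ! p) ?k = p" using p by (intro step_pos_eqI) auto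
  have "?k = count_list (take (Suc p) D) (D ! p)" using p by (simp add: count_list_take_Suc)
  then have "?k \<in> {1..n}" using count_list_take_le[of "Suc p" D "D ! p"] c by simp
  have same: "p \<in> step_pos D s ` C \<longleftrightarrow> D ! p = s \<and> ?k \<in> C" if "C \<subseteq> {1..n}" for s C
  proof
    assume "p \<in> step_pos D s ` C"
    then obtain l where l: "l \<in> C" "p = step_pos D s l" by blast
    moreover have "1 \<le> l" "l \<le> count_list D s" using l that c by auto
    note step_pos_props(2,3)[OF this]
    ultimately show "D ! p = s \<and> ?k \<in> C" using \<open>1 \<le> l\<close> by simp
  qed (use k in force)
  show "p \<in> - (step_pos D UpStep ` A \<union> step_pos D DownStep ` B) \<longleftrightarrow>
      p \<in> step_pos D UpStep ` ({1..n} - A) \<union> step_pos D DownStep ` ({1..n} - B)"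
    using same[OF A] same[OF B] same[of "{1..n} - A"] same[of "{1..n} - B"] \<open>?k \<in> {1..n}\<close>
    by (cases "D ! p") auto
qed

text \<open>The increasing enumeration of the numbers outside the block of length d that starts at t. After the
  contraction of [i,j] to the point i, with d = j - i, an up step (k) comes from (\<open>skip i d k\<close>), since
  i to j - 1 are deleted, and a down step (\<open>\<Sigma>\<close>k) from (\<open>\<Sigma>\<close>(\<open>skip (Suc i) d k\<close>)), since i + 1 to j are deleted.
  On intervals this replaces a left end i by i and a right end i by j.\<close>

definition skip :: "nat \<Rightarrow> nat \<Rightarrow> nat \<Rightarrow> nat" where
  "skip t d k = (if k < t then k else k + d)"

lemma skip_le_iff: "skip t d a \<le> skip t d b \<longleftrightarrow> a \<le> b"
  by (auto simp: skip_def)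

lemma skip_eq_iff: "skip t d a = skip t d b \<longleftrightarrow> a = b"
  by (auto simp: skip_def)

text \<open>Contraction preserves and reflects disjointness of intervals, where a right end is compared with
  a left end.\<close>

lemma skip_less_skip_Suc_iff: "skip t d a < skip (Suc t) d b \<longleftrightarrow> a < b"
  by (auto simp: skip_def)

lemma skip_Suc_less_skip: "a < b \<Longrightarrow> skip (Suc t) d a < skip t d b"
  by (auto simp: skip_def)

context
  fixes n :: nat and D :: "step list"
  assumes D: "dyck_path n D"
begin

lemma path_left_heights:
  assumes i: "1 \<le> i" "i \<le> n"
  shows "dyck_path (i - 1) (path_left D i)"
    and "\<And>a k. a < i \<Longrightarrow> 1 \<le> k \<Longrightarrow> k < i \<Longrightarrow>
           a \<le> down_height (path_left D i) k \<longleftrightarrow> a \<le> down_height D k"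
    and "\<And>a k. a < i \<Longrightarrow> 1 \<le> k \<Longrightarrow> k < i \<Longrightarrow>
           down_height (path_left D i) k < a \<longleftrightarrow> down_height D k < a"
proof -
  have E: "path_left D i = nths D (step_pos D UpStep ` (\<lambda>k. k) ` {1..i-1} \<union> step_pos D DownStep ` (\<lambda>k. k) ` {1..i-1})"
    unfolding path_left_def using i by (simp add: atLeastLessThanSuc_atLeastAtMost[symmetric])
  have mono: "strict_mono_on {1..i-1} (\<lambda>k. k)" "(\<lambda>k. k) ` {1..i-1} \<subseteq> {1..n}"
    using i by (auto simp: strict_mono_on_def)
  note sub = le_down_height_subword_iff[OF D mono mono E] dyck_path_subword[OF D mono mono E]
  show "dyck_path (i - 1) (path_left D i)"
    using D i by (intro sub(2)) (auto simp: dyck_path_iff)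
  show le: "a \<le> down_height (path_left D i) k \<longleftrightarrow> a \<le> down_height D k"
    if "a < i" "1 \<le> k" "k < i" for a k
    using sub(1)[of a k] that by (cases "a = 0") auto
  show "down_height (path_left D i) k < a \<longleftrightarrow> down_height D k < a"
    if "a < i" "1 \<le> k" "k < i" for a k
    using le[OF that] by linarith
qed

lemma path_right_heights:
  assumes i: "1 \<le> i" "i \<le> n"
  shows "dyck_path (n - i) (path_right n D i)"
    and "\<And>a k. 1 \<le> a \<Longrightarrow> a \<le> n - i \<Longrightarrow> 1 \<le> k \<Longrightarrow> k \<le> n - i \<Longrightarrow>
           a \<le> down_height (path_right n D i) k \<longleftrightarrow> a + i \<le> down_height D (k + i)"
    and "\<And>a k. 1 \<le> a \<Longrightarrow> a \<le> n - i \<Longrightarrow> 1 \<le> k \<Longrightarrow> k \<le> n - i \<Longrightarrow>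
           down_height (path_right n D i) k < a \<longleftrightarrow> down_height D (k + i) < a + i"
proof -
  have im: "(\<lambda>k. k + i) ` {1..n-i} = {i+1..n}"
    using i image_add_atLeastAtMost'[of i 1 "n-i"] by (simp add: add.commute)
  have E: "path_right n D i = nths D (step_pos D UpStep ` (\<lambda>k. k + i) ` {1..n-i} \<union> step_pos D DownStep ` (\<lambda>k. k + i) ` {1..n-i})"
    unfolding path_right_def im by (rule refl)
  have mono: "strict_mono_on {1..n-i} (\<lambda>k. k + i)" "(\<lambda>k. k + i) ` {1..n-i} \<subseteq> {1..n}"
    using i by (auto simp: strict_mono_on_def)
  note sub = le_down_height_subword_iff[OF D mono mono E] dyck_path_subword[OF D mono mono E]
  show "dyck_path (n - i) (path_right n D i)"
    using D i by (intro sub(2)) (auto simp: dyck_path_iff)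
  show le: "a \<le> down_height (path_right n D i) k \<longleftrightarrow> a + i \<le> down_height D (k + i)"
    if "1 \<le> a" "a \<le> n - i" "1 \<le> k" "k \<le> n - i" for a k
    using sub(1)[of a k] that by auto
  show "down_height (path_right n D i) k < a \<longleftrightarrow> down_height D (k + i) < a + i"
    if "1 \<le> a" "a \<le> n - i" "1 \<le> k" "k \<le> n - i" for a k
    using le[OF that] by linarith
qed

lemma path_diamond_heights:
  assumes ij: "1 \<le> i" "i < j" "j \<le> n" "j \<le> down_height D i"
  shows "dyck_path (n + i - j) (path_diamond D i j)"
    and "\<And>a k. 1 \<le> a \<Longrightarrow> a \<le> n + i - j \<Longrightarrow> 1 \<le> k \<Longrightarrow> k \<le> n + i - j \<Longrightarrow>
           a \<le> down_height (path_diamond D i j) k \<longleftrightarrow>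
           skip i (j - i) a \<le> down_height D (skip (Suc i) (j - i) k)"
    and "\<And>a k. 1 \<le> a \<Longrightarrow> a \<le> n + i - j \<Longrightarrow> 1 \<le> k \<Longrightarrow> k \<le> n + i - j \<Longrightarrow>
           down_height (path_diamond D i j) k < a \<longleftrightarrow>
           down_height D (skip (Suc i) (j - i) k) < skip i (j - i) a"
proof -
  let ?m = "n + i - j" and ?d = "j - i"
  have im: "skip t ?d ` {1..?m} = {1..n} - {t..<t + ?d}" if "1 \<le> t" "t + ?d \<le> Suc n" for t
  proof (intro subset_antisym subsetI)
    fix x assume x: "x \<in> {1..n} - {t..<t + ?d}"
    then have "x = skip t ?d (if x < t then x else x - ?d)"
      "(if x < t then x else x - ?d) \<in> {1..?m}"
      using ij that by (auto simp: skip_def)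
    then show "x \<in> skip t ?d ` {1..?m}" by blast
  qed (use ij that in \<open>auto simp: skip_def\<close>)
  have ups: "skip i ?d ` {1..?m} = {1..n} - {i..<j}" using im[of i] ij by simp
  have downs: "skip (Suc i) ?d ` {1..?m} = {1..n} - {i+1..j}"
    using im[of "Suc i"] ij by (simp add: atLeastLessThanSuc_atLeastAtMost)
  have E: "path_diamond D i j = nths D (step_pos D UpStep ` skip i ?d ` {1..?m} \<union>
      step_pos D DownStep ` skip (Suc i) ?d ` {1..?m})"
    unfolding ups downs path_diamond_def by (rule nths_Compl_steps[OF D]) (use ij in auto)
  have mono: "strict_mono_on {1..?m} (skip t ?d)" for t by (auto simp: strict_mono_on_def skip_def)
  have f: "skip (Suc i) ?d ` {1..?m} \<subseteq> {1..n}" unfolding downs by blast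
  have g: "skip i ?d ` {1..?m} \<subseteq> {1..n}" unfolding ups by blast
  note sub = le_down_height_subword_iff[OF D mono f mono g E] dyck_path_subword[OF D mono f mono g E]
  show "dyck_path ?m (path_diamond D i j)"
  proof (rule sub(2))
    fix k assume k: "k \<in> {1..?m}"
    \<comment> \<open>only at k = i do the two enumerations differ, and there (i,j) lying below D is needed\<close>
    have "k \<le> n" "k \<noteq> i \<Longrightarrow> skip i ?d k = skip (Suc i) ?d k" "skip (Suc i) ?d k \<in> {1..n}"
      "skip i ?d i = j" "skip (Suc i) ?d i = i"
      using k f ij by (auto simp: skip_def)
    then show "skip i ?d k \<le> down_height D (skip (Suc i) ?d k)"
      using D ij by (cases "k = i") (auto simp: dyck_path_iff)
  qed
  show le: "a \<le> down_height (path_diamond D i j) k \<longleftrightarrow> skip i ?d a \<le> down_height D (skip (Suc i) ?d k)"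
    if "1 \<le> a" "a \<le> ?m" "1 \<le> k" "k \<le> ?m" for a k
    using sub(1)[of a k] that by auto
  show "down_height (path_diamond D i j) k < a \<longleftrightarrow> down_height D (skip (Suc i) ?d k) < skip i ?d a"
    if "1 \<le> a" "a \<le> ?m" "1 \<le> k" "k \<le> ?m" for a k
    using le[OF that] by linarith
qed

end


section \<open>The index set and compatibility in terms of heights\<close>

lemma index_set_simps [simp]:
  "Up k \<in> index_set n D \<longleftrightarrow> 1 \<le> k \<and> k \<le> n"
  "Down k \<in> index_set n D \<longleftrightarrow> 1 \<le> k \<and> k \<le> n"
  "Diamond i j \<in> index_set n D \<longleftrightarrow> 1 \<le> i \<and> i < j \<and> j \<le> n \<and> j \<le> down_height D i"
  by (auto simp: index_set_def on_or_below_def)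

lemma finite_index_set: "finite (index_set n D)"
proof (rule finite_subset)
  show "index_set n D \<subseteq> Up ` {1..n} \<union> Down ` {1..n} \<union> case_prod Diamond ` ({1..n} \<times> {1..n})"
    by (auto simp: index_set_def on_or_below_def)
qed simp

lemma compatible_sym: "compatible D X Y \<longleftrightarrow> compatible D Y X"
  by (cases X; cases Y) auto

lemma compatible_refl: "compatible D X X"
  by (cases X) auto

lemma compatible_Diamond_Diamond_iff:
  assumes "i < j" "k < l"
  shows "compatible D (Diamond i j) (Diamond k l) \<longleftrightarrow>
    k \<le> i \<and> j \<le> l \<or> i \<le> k \<and> l \<le> j \<or> j < k \<or> l < i"
proof -
  have "{i..j} \<inter> {k..l} = {max i k..min j l}" by auto
  then show ?thesis using assms by auto
qed

lemma compatible_Up_Down_iff: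
  assumes "dyck_path n D" "1 \<le> a" "a \<le> n" "1 \<le> b" "b \<le> n"
  shows "compatible D (Up a) (Down b) \<longleftrightarrow> a < b \<or> down_height D b < a"
    "compatible D (Down b) (Up a) \<longleftrightarrow> a < b \<or> down_height D b < a"
  using assms step_pos_Down_less_Up_iff[of n D a b] by (auto simp: compatible.simps(6,7))

text \<open>From here on compatibility is unfolded into inequalities between labels and heights instead of
  interval inclusions and step positions.\<close>

declare compatible.simps(1,6,7) [simp del]

lemmas compat_simps = compatible.simps(2-5) compatible.simps(8,9)
  compatible_Diamond_Diamond_iff


section \<open>Varieties defined by u-equations\<close>

text \<open>The variety of u-equations for an arbitrary relation c in place of compatibility. This generality
  allows compatibility to be pulled back along a map of index sets, and covers disjoint unions.\<close>

definition u_variety :: "'a set \<Rightarrow> ('a \<Rightarrow> 'a \<Rightarrow> bool) \<Rightarrow> ('a \<Rightarrow> complex) set" where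
  "u_variety I c = {u \<in> extensional I. \<forall>x\<in>I. u x + (\<Prod>y\<in>{y \<in> I. \<not> c x y}. u y) = 1}"

lemma config_space_eq_u_variety: "config_space n D = u_variety (index_set n D) (compatible D)"
  by (simp add: config_space_def u_variety_def)

text \<open>An equation of an index in one summand involves only coordinates of that summand, since e relates
  all pairs from different summands.\<close>

lemma variety_prod_u_variety:
  assumes "\<And>x y. x \<in> I \<Longrightarrow> y \<in> I \<Longrightarrow> e (Inl x) (Inl y) \<longleftrightarrow> c x y"
    and "\<And>x y. x \<in> J \<Longrightarrow> y \<in> J \<Longrightarrow> e (Inr x) (Inr y) \<longleftrightarrow> d x y"
    and "\<And>x y. x \<in> I \<Longrightarrow> y \<in> J \<Longrightarrow> e (Inl x) (Inr y) \<and> e (Inr y) (Inl x)"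
  shows "variety_prod (u_variety I c) (u_variety J d) = u_variety (I <+> J) e"
proof -
  have l: "(\<Prod>y\<in>{y \<in> I <+> J. \<not> e (Inl x) y}. w y) = (\<Prod>y\<in>{y \<in> I. \<not> c x y}. w (Inl y))"
    if "x \<in> I" for w x
  proof -
    have "{y \<in> I <+> J. \<not> e (Inl x) y} = Inl ` {y \<in> I. \<not> c x y}"
      using assms that by auto
    then show ?thesis by (simp add: prod.reindex)
  qed
  have r: "(\<Prod>y\<in>{y \<in> I <+> J. \<not> e (Inr x) y}. w y) = (\<Prod>y\<in>{y \<in> J. \<not> d x y}. w (Inr y))"
    if "x \<in> J" for w x
  proof -
    have "{y \<in> I <+> J. \<not> e (Inr x) y} = Inr ` {y \<in> J. \<not> d x y}"
      using assms that by auto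
    then show ?thesis by (simp add: prod.reindex)
  qed
  have eq: "w \<in> u_variety (I <+> J) e \<longleftrightarrow> w \<circ> Inl \<in> u_variety I c \<and> w \<circ> Inr \<in> u_variety J d" for w
  proof -
    have "w \<in> extensional (I <+> J) \<longleftrightarrow> w \<circ> Inl \<in> extensional I \<and> w \<circ> Inr \<in> extensional J"
      by (simp add: extensional_def split_sum_all Plus_def image_iff) blast
    moreover have "(\<forall>z\<in>I <+> J. P z) \<longleftrightarrow> (\<forall>x\<in>I. P (Inl x)) \<and> (\<forall>y\<in>J. P (Inr y))" for P
      by blast
    ultimately show ?thesis by (simp add: u_variety_def l r) blast
  qed
  have "w \<in> variety_prod V W \<longleftrightarrow> w \<circ> Inl \<in> V \<and> w \<circ> Inr \<in> W"
    for w :: "'a + 'b \<Rightarrow> complex" and V W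
  proof
    assume "w \<circ> Inl \<in> V \<and> w \<circ> Inr \<in> W"
    moreover have "w = case_sum (w \<circ> Inl) (w \<circ> Inr)" by (simp add: comp_def surjective_sum)
    ultimately show "w \<in> variety_prod V W" unfolding variety_prod_def by blast
  qed (auto simp: variety_prod_def comp_def)
  then show ?thesis using eq by blast
qed

text \<open>A point of the stratum is mapped to its coordinates in the link of X; conversely a point of the variety of the
  link is extended by 0 at X and by 1 at the indices incompatible with X. The equation at X then holds
  because its product consists of ones.\<close>

lemma u_variety_stratum_iso:
  assumes fin: "finite I" and X: "X \<in> I" "c X X"
    and sym: "\<And>x y. x \<in> I \<Longrightarrow> y \<in> I \<Longrightarrow> c x y \<longleftrightarrow> c y x"
    and \<phi>: "bij_betw \<phi> J {z \<in> I. z \<noteq> X \<and> c X z}"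
  shows "variety_iso I {u \<in> u_variety I c. u X = 0} J (u_variety J (\<lambda>a b. c (\<phi> a) (\<phi> b)))"
proof -
  let ?L = "{z \<in> I. z \<noteq> X \<and> c X z}"
  let ?S = "{u \<in> u_variety I c. u X = 0}"
  let ?W = "u_variety J (\<lambda>a b. c (\<phi> a) (\<phi> b))"
  define \<psi> where "\<psi> = inv_into J \<phi>"
  have \<phi>L: "\<phi> a \<in> ?L" if "a \<in> J" for a using \<phi> that by (auto simp: bij_betw_def)
  have \<psi>J: "\<psi> z \<in> J" "\<phi> (\<psi> z) = z" if "z \<in> ?L" for z
    using \<phi> that by (auto simp: bij_betw_def \<psi>_def inv_into_into f_inv_into_f)
  have \<psi>\<phi>: "\<psi> (\<phi> a) = a" if "a \<in> J" for a
    using \<phi> that by (auto simp: bij_betw_def \<psi>_def)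
  \<comment> \<open>the product in the equation of y contains the factor \<open>u X = 0\<close>\<close>
  have one: "u y = 1" if "u \<in> ?S" "y \<in> I" "\<not> c X y" for u y
  proof -
    have "X \<in> {z \<in> I. \<not> c y z}" using that X sym[of y X] by simp
    then have "(\<Prod>z\<in>{z \<in> I. \<not> c y z}. u z) = 0"
      using that fin by (intro prod_zero) auto
    moreover have "u y + (\<Prod>z\<in>{z \<in> I. \<not> c y z}. u z) = 1"
      using that by (auto simp: u_variety_def)
    ultimately show ?thesis by simp
  qed
  \<comment> \<open>X itself does not occur in the product, as z is compatible with X,
     and the indices outside the link contribute ones\<close>
  have link_prod: "(\<Prod>y\<in>{y \<in> I. \<not> c z y}. u y) = (\<Prod>b\<in>{b \<in> J. \<not> c z (\<phi> b)}. u (\<phi> b))"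
    if one: "\<And>y. y \<in> I \<Longrightarrow> \<not> c X y \<Longrightarrow> u y = (1::complex)" and z: "z \<in> ?L" for u z
  proof -
    have "c z X" using z X sym[of z X] by simp
    then have "(\<Prod>y\<in>{y \<in> I. \<not> c z y}. u y) = (\<Prod>y\<in>{y \<in> ?L. \<not> c z y}. u y)"
      using fin one by (intro prod.mono_neutral_right) auto
    also have "bij_betw \<phi> {b \<in> J. \<not> c z (\<phi> b)} {y \<in> ?L. \<not> c z y}"
      using \<phi> unfolding bij_betw_def by (auto simp: inj_on_def)
    note prod.reindex_bij_betw[OF this, of u, symmetric]
    finally show ?thesis .
  qed
  define f where "f u = restrict (\<lambda>a. u (\<phi> a)) J" for u :: "'a \<Rightarrow> complex"
  define g where "g w = restrict (\<lambda>z. if z = X then 0 else if c X z then w (\<psi> z) else 1) I"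
    for w :: "'b \<Rightarrow> complex"
  have f: "f u \<in> ?W" if u: "u \<in> ?S" for u
  proof -
    have "u (\<phi> a) + (\<Prod>b\<in>{b \<in> J. \<not> c (\<phi> a) (\<phi> b)}. u (\<phi> b)) = 1" if "a \<in> J" for a
      using link_prod[of u "\<phi> a"] one u \<phi>L[OF that] by (auto simp: u_variety_def)
    then show ?thesis by (auto simp: u_variety_def f_def)
  qed
  have g: "g w \<in> ?S" if w: "w \<in> ?W" for w
  proof -
    have "g w z + (\<Prod>y\<in>{y \<in> I. \<not> c z y}. g w y) = 1" if z: "z \<in> I" for z
    proof -
      consider "z = X" | "z \<noteq> X" "\<not> c X z" | "z \<in> ?L" using z by blast
      then show ?thesis
      proof cases
        case 1
        then have "(\<Prod>y\<in>{y \<in> I. \<not> c z y}. g w y) = 1"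
          using X by (intro prod.neutral) (auto simp: g_def)
        then show ?thesis using 1 X by (simp add: g_def)
      next
        case 2
        then have "X \<in> {y \<in> I. \<not> c z y}" using z X sym[of z X] by simp
        then have "(\<Prod>y\<in>{y \<in> I. \<not> c z y}. g w y) = 0"
          using fin X by (intro prod_zero) (auto simp: g_def intro!: bexI[of _ X])
        then show ?thesis using 2 z by (simp add: g_def)
      next
        case 3
        have "(\<Prod>y\<in>{y \<in> I. \<not> c z y}. g w y) = (\<Prod>b\<in>{b \<in> J. \<not> c z (\<phi> b)}. g w (\<phi> b))"
          using X 3 by (intro link_prod) (auto simp: g_def)
        also have "\<dots> = (\<Prod>b\<in>{b \<in> J. \<not> c z (\<phi> b)}. w b)"
          using \<phi>L \<psi>\<phi> by (intro prod.cong) (auto simp: g_def)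
        finally show ?thesis using 3 w \<psi>J[OF 3] by (auto simp: g_def u_variety_def)
      qed
    qed
    then show ?thesis using X by (auto simp: u_variety_def g_def)
  qed
  have "regular_map I ?S J ?W f"
    unfolding regular_map_def
  proof (intro conjI ballI)
    fix y assume y: "y \<in> J"
    have "(\<lambda>u. u (\<phi> y)) \<in> poly_fun I" using \<phi>L[OF y] by (intro poly_fun.coord) simp
    then show "\<exists>p\<in>poly_fun I. \<forall>u\<in>?S. f u y = p u" using y by (auto simp: f_def)
  qed (use f in auto)
  moreover have "regular_map J ?W I ?S g"
    unfolding regular_map_def
  proof (intro conjI ballI)
    fix z assume z: "z \<in> I"
    have "(\<lambda>w. if z = X then 0 else if c X z then w (\<psi> z) else 1) \<in> poly_fun J"
      using \<psi>J(1)[of z] z by (cases "z = X"; cases "c X z") (auto intro: poly_fun.const poly_fun.coord)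
    then show "\<exists>p\<in>poly_fun J. \<forall>u\<in>?W. g u z = p u" 
      by (rule bexI[rotated]) (use z in \<open>auto simp: g_def\<close>)
  qed (use g in auto)
  moreover have "g (f u) = u" if u: "u \<in> ?S" for u
  proof (rule extensionalityI[of _ I])
    fix z assume z: "z \<in> I"
    show "g (f u) z = u z"
      using u z one[OF u z] \<psi>J[of z] by (auto simp: f_def g_def)
  qed (use u in \<open>auto simp: g_def u_variety_def\<close>)
  moreover have "f (g w) = w" if w: "w \<in> ?W" for w
  proof (rule extensionalityI[of _ J])
    fix a assume a: "a \<in> J"
    show "f (g w) a = w a" using a \<phi>L[OF a] \<psi>\<phi>[OF a] by (auto simp: f_def g_def)
  qed (use w in \<open>auto simp: f_def u_variety_def\<close>)
  ultimately show ?thesis unfolding variety_iso_def by blast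
qed

text \<open>Restriction to the link and splitting of the link together leave a purely combinatorial condition,
  to be checked for each kind of index.\<close>

lemma stratum_iso_prodI:
  assumes X: "X \<in> index_set n D"
    and cover: "\<phi> ` index_set m E \<union> \<psi> ` index_set l F = {Z \<in> index_set n D. Z \<noteq> X \<and> compatible D X Z}"
    and inj: "inj_on \<phi> (index_set m E)" "inj_on \<psi> (index_set l F)"
    and \<phi>: "\<And>Y Z. Y \<in> index_set m E \<Longrightarrow> Z \<in> index_set m E \<Longrightarrow>
              compatible D (\<phi> Y) (\<phi> Z) \<longleftrightarrow> compatible E Y Z"
    and \<psi>: "\<And>Y Z. Y \<in> index_set l F \<Longrightarrow> Z \<in> index_set l F \<Longrightarrow>
              compatible D (\<psi> Y) (\<psi> Z) \<longleftrightarrow> compatible F Y Z"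
    and cross: "\<And>Y Z. Y \<in> index_set m E \<Longrightarrow> Z \<in> index_set l F \<Longrightarrow>
              \<phi> Y \<noteq> \<psi> Z \<and> compatible D (\<phi> Y) (\<psi> Z)"
  shows "variety_iso (index_set n D) (config_stratum n D X)
    (index_set m E <+> index_set l F) (variety_prod (config_space m E) (config_space l F))"
proof -
  let ?\<chi> = "case_sum \<phi> \<psi>"
  let ?J = "index_set m E <+> index_set l F"
  have "bij_betw ?\<chi> ?J {Z \<in> index_set n D. Z \<noteq> X \<and> compatible D X Z}"
    unfolding bij_betw_def
  proof
    show "inj_on ?\<chi> ?J"
    proof (rule inj_onI)
      fix p q assume "p \<in> ?J" "q \<in> ?J" "?\<chi> p = ?\<chi> q"
      then show "p = q"
        using inj cross by (cases p; cases q) (auto dest: inj_onD, metis+)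
    qed
    have "?\<chi> ` ?J = \<phi> ` index_set m E \<union> \<psi> ` index_set l F"
      by (simp add: Plus_def image_Un image_image)
    then show "?\<chi> ` ?J = {Z \<in> index_set n D. Z \<noteq> X \<and> compatible D X Z}"
      using cover by simp
  qed
  note u_variety_stratum_iso[OF finite_index_set X compatible_refl compatible_sym this]
  moreover have "variety_prod (config_space m E) (config_space l F) =
      u_variety ?J (\<lambda>p q. compatible D (?\<chi> p) (?\<chi> q))"
    unfolding config_space_eq_u_variety
    by (rule variety_prod_u_variety) (use \<phi> \<psi> cross compatible_sym in auto)
  ultimately show ?thesis by (simp add: config_stratum_def config_space_eq_u_variety)
qed


section \<open>The links of the indices\<close>

fun relabel :: "(nat \<Rightarrow> nat) \<Rightarrow> (nat \<Rightarrow> nat) \<Rightarrow> index \<Rightarrow> index" where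
  "relabel f g (Up k) = Up (g k)"
| "relabel f g (Down k) = Down (f k)"
| "relabel f g (Diamond k l) = Diamond (f k) (g l)"

text \<open>The full path of length j - i - 1 embeds into the intervals contained in [i,j]: up steps become
  the proper prefixes and down steps the proper suffixes of [i,j].\<close>

fun nested_diamond :: "nat \<Rightarrow> nat \<Rightarrow> index \<Rightarrow> index" where
  "nested_diamond i j (Up k) = Diamond i (i + k)"
| "nested_diamond i j (Down k) = Diamond (i + k) j"
| "nested_diamond i j (Diamond k l) = Diamond (i + k) (i + l)"

text \<open>The down step (\<open>\<Sigma>\<close>k) of the left path, k < i, is represented in the link of the up step (i) by whichever
  of (\<open>\<Sigma>\<close>k) and (k,i) belongs to it. In the second case
  (\<open>\<Sigma>\<close>k) comes after (i), hence after all up steps of the left path; it and (k,i) both have left end k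
  and extend beyond all labels of the left path, so they impose the same conditions there.\<close>

fun left_of_Up :: "step list \<Rightarrow> nat \<Rightarrow> index \<Rightarrow> index" where
  "left_of_Up D i (Up k) = Up k"
| "left_of_Up D i (Down k) = (if down_height D k < i then Down k else Diamond k i)"
| "left_of_Up D i (Diamond k l) = Diamond k l"

text \<open>Dually, the up step (k + i) of D is in the link of the down step (\<open>\<Sigma>\<close>i) only if it comes after
  (\<open>\<Sigma>\<close>i), and otherwise the diamond (i,k + i) lies below D and takes its place.\<close>

fun right_of_Down :: "step list \<Rightarrow> nat \<Rightarrow> index \<Rightarrow> index" where
  "right_of_Down D i (Up k) = (if down_height D i < k + i then Up (k + i) else Diamond i (k + i))"
| "right_of_Down D i (Down k) = Down (k + i)"
| "right_of_Down D i (Diamond k l) = Diamond (k + i) (l + i)"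

context
  fixes n :: nat and D :: "step list"
  assumes D: "dyck_path n D"
begin

text \<open>An interval compatible with [i,j] is either contained in it, which gives the full path, or contains
  it or is disjoint from it, which gives the contracted path.\<close>

lemma stratum_Diamond:
  assumes X: "Diamond i j \<in> index_set n D"
  defines "m \<equiv> j - i - 1" and "l \<equiv> n + i - j"
  shows "variety_iso (index_set n D) (config_stratum n D (Diamond i j))
    (index_set m (full_path m) <+> index_set l (path_diamond D i j))
    (variety_prod (config_space m (full_path m)) (config_space l (path_diamond D i j)))"
proof -
  let ?\<phi> = "nested_diamond i j" and ?\<psi> = "relabel (skip (Suc i) (j - i)) (skip i (j - i))"
  let ?E = "full_path m" and ?F = "path_diamond D i j"
  let ?I = "index_set n D" and ?J = "index_set m ?E" and ?K = "index_set l ?F"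
  have ij: "1 \<le> i" "i < j" "j \<le> n" "j \<le> down_height D i" using X by auto
  \<comment> \<open>one inequality in all the forms in which it occurs after unfolding compatibility\<close>
  have less: "i + a < j" "i + a \<le> j" "\<not> j \<le> i + a" "\<not> j < i + a" "i + a \<noteq> j" "j \<noteq> i + a"
    if "a \<le> m" for a
    using ij that by (auto simp: m_def)
  have E: "dyck_path m ?E" by (rule dyck_path_full_path)
  have hE: "down_height ?E k = m" if "1 \<le> k" "k \<le> m" for k
    using that by (simp add: down_height_full_path)
  have cE: "compatible ?E (Up a) (Down b) \<longleftrightarrow> a < b" "compatible ?E (Down b) (Up a) \<longleftrightarrow> a < b"
    if "1 \<le> a" "a \<le> m" "1 \<le> b" "b \<le> m" for a b
    using that compatible_Up_Down_iff[OF E that] hE[of b] by auto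
  have F: "dyck_path l ?F" unfolding l_def by (rule path_diamond_heights(1)[OF D ij])
  note hF = path_diamond_heights(2,3)[OF D ij, folded l_def]
  have hD: "b \<le> down_height D k" if "i \<le> k" "k < b" "b \<le> j" for b k
    using down_height_mono[OF D, of i k] that ij by auto
  have bounds: "Suc 0 \<le> a \<Longrightarrow> Suc 0 \<le> skip t (j - i) a" "a \<le> l \<Longrightarrow> skip t (j - i) a \<le> n" for a t
    using ij by (auto simp: skip_def l_def)
  note simps = compat_simps compatible_Up_Down_iff[OF D] compatible_Up_Down_iff[OF F]
  show ?thesis
  proof (rule stratum_iso_prodI[OF X])
    show "?\<phi> ` ?J \<union> ?\<psi> ` ?K = {Z \<in> ?I. Z \<noteq> Diamond i j \<and> compatible D (Diamond i j) Z}" (is "_ = ?L")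
    proof (intro subset_antisym subsetI)
      fix Z assume "Z \<in> ?\<phi> ` ?J \<union> ?\<psi> ` ?K"
      then consider Y where "Y \<in> ?J" "Z = ?\<phi> Y" | Y where "Y \<in> ?K" "Z = ?\<psi> Y" by blast
      then show "Z \<in> ?L"
      proof cases
        case 1
        then show ?thesis using ij
          by (cases Y) (auto simp: hD m_def compatible_Diamond_Diamond_iff)
      next
        case 2
        then show ?thesis using ij hF
          by (cases Y) (auto simp: skip_def l_def compatible_Diamond_Diamond_iff)
      qed
    next
      fix Z assume "Z \<in> ?L"
      then have Z: "Z \<in> ?I" "Z \<noteq> Diamond i j" "compatible D (Diamond i j) Z" by auto
      \<comment> \<open>the contraction of the interval from i to j to the point i, which on the labels that are
         kept inverts both enumerations\<close>
      define e where "e = (\<lambda>k. if k \<le> i then k else k - (j - i))"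
      show "Z \<in> ?\<phi> ` ?J \<union> ?\<psi> ` ?K"
      proof (cases Z)
        case (Up k)
        then have "Up (e k) \<in> ?K" "Z = ?\<psi> (Up (e k))" using Z ij by (auto simp: e_def l_def skip_def)
        then show ?thesis by blast
      next
        case (Down k)
        then have "Down (e k) \<in> ?K" "Z = ?\<psi> (Down (e k))" using Z ij by (auto simp: e_def l_def skip_def)
        then show ?thesis by blast
      next
        case (Diamond a b)
        show ?thesis
        proof (cases "i \<le> a \<and> b \<le> j")
          case True
          then consider "a = i" "b < j" | "i < a" "b = j" | "i < a" "b < j" using Z Diamond by fastforce
          then show ?thesis
          proof cases
            case 1
            then have "Up (b - i) \<in> ?J" "Z = ?\<phi> (Up (b - i))" using Diamond Z by (auto simp: m_def)
            then show ?thesis by blast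
          next
            case 2
            then have "Down (a - i) \<in> ?J" "Z = ?\<phi> (Down (a - i))" using Diamond Z by (auto simp: m_def)
            then show ?thesis by blast
          next
            case 3
            then have "Diamond (a - i) (b - i) \<in> ?J" "Z = ?\<phi> (Diamond (a - i) (b - i))"
              using Diamond Z hE[of "a - i"] by (auto simp: m_def)
            then show ?thesis by blast
          qed
        next
          case False
          have ab: "1 \<le> a" "a < b" "b \<le> n" "b \<le> down_height D a" using Z Diamond by auto
          have "a \<le> i \<and> j \<le> b \<or> b < i \<or> j < a"
            using Z Diamond False ab ij compatible_Diamond_Diamond_iff[OF ij(2) ab(2), of D] by auto
          then have e: "skip (Suc i) (j - i) (e a) = a" "skip i (j - i) (e b) = b"
            "1 \<le> e a" "e a < e b" "e b \<le> l"
            using ab ij False by (auto simp: e_def skip_def l_def)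
          then have "Diamond (e a) (e b) \<in> ?K" using ab hF[of "e b" "e a"] by simp
          moreover have "Z = ?\<psi> (Diamond (e a) (e b))" using Diamond e by simp
          ultimately show ?thesis by blast
        qed
      qed
    qed
    show "inj_on ?\<phi> ?J"
    proof (rule inj_onI)
      fix Y Z assume "Y \<in> ?J" "Z \<in> ?J" "?\<phi> Y = ?\<phi> Z"
      then show "Y = Z" by (cases Y; cases Z) (auto simp: m_def)
    qed
    show "inj_on ?\<psi> ?K"
    proof (rule inj_onI)
      fix Y Z assume "Y \<in> ?K" "Z \<in> ?K" "?\<psi> Y = ?\<psi> Z"
      then show "Y = Z" by (cases Y; cases Z) (auto simp: skip_eq_iff)
    qed
  next
    fix Y Z assume "Y \<in> ?J" "Z \<in> ?J"
    then show "compatible D (?\<phi> Y) (?\<phi> Z) \<longleftrightarrow> compatible ?E Y Z"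
      using ij(2) by (cases Y; cases Z) (auto simp: simps cE less)
  next
    fix Y Z assume "Y \<in> ?K" "Z \<in> ?K"
    then show "compatible D (?\<psi> Y) (?\<psi> Z) \<longleftrightarrow> compatible ?F Y Z"
      by (cases Y; cases Z) (auto simp: simps hF bounds skip_le_iff skip_less_skip_Suc_iff skip_Suc_less_skip)
  next
    fix Y Z assume "Y \<in> ?J" "Z \<in> ?K"
    then show "?\<phi> Y \<noteq> ?\<psi> Z \<and> compatible D (?\<phi> Y) (?\<psi> Z)"
      using ij by (cases Y; cases Z) (auto simp: compat_simps m_def l_def skip_def)
  qed
qed

text \<open>The link splits into the indices supported to the right of i, which form the right path with all labels
  shifted by i, and the left part, in which diamonds ending in i stand in for down steps after (i).\<close>

lemma stratum_Up:
  assumes X: "Up i \<in> index_set n D"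
  shows "variety_iso (index_set n D) (config_stratum n D (Up i))
    (index_set (n - i) (path_right n D i) <+> index_set (i - 1) (path_left D i))
    (variety_prod (config_space (n - i) (path_right n D i)) (config_space (i - 1) (path_left D i)))"
proof -
  let ?\<phi> = "relabel (\<lambda>k. k + i) (\<lambda>k. k + i)" and ?\<psi> = "left_of_Up D i"
  let ?E = "path_right n D i" and ?F = "path_left D i"
  let ?I = "index_set n D" and ?J = "index_set (n - i) ?E" and ?K = "index_set (i - 1) ?F"
  have i: "1 \<le> i" "i \<le> n" using X by auto
  note E = path_right_heights(1)[OF D i] and F = path_left_heights(1)[OF D i]
  note hE = path_right_heights(2,3)[OF D i] and hF = path_left_heights(2,3)[OF D i]
  have h: "down_height D k \<ge> k" if "1 \<le> k" "k \<le> n" for k using D that by (simp add: dyck_path_iff)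
  \<comment> \<open>A down step before (i) precedes every down step after (i). So when
     (\<open>\<Sigma>\<close>k) stays a step and (\<open>\<Sigma>\<close>l) is replaced by the
     diamond (l,i), the two are compatible.\<close>
  have order: "k \<le> l" if "down_height D k < i" "\<not> down_height D l < i" "k \<le> i - 1" "1 \<le> l" for k l
  proof (rule ccontr)
    assume "\<not> k \<le> l"
    moreover have "k \<le> n" using that(3) i by linarith
    ultimately have "down_height D l \<le> down_height D k" using down_height_mono[OF D, of l k] that i by simp
    then show False using that by simp
  qed
  note simps = compat_simps compatible_Up_Down_iff[OF D] compatible_Up_Down_iff[OF E] compatible_Up_Down_iff[OF F]
  show ?thesis
  proof (rule stratum_iso_prodI[OF X])
    show "?\<phi> ` ?J \<union> ?\<psi> ` ?K = {Z \<in> ?I. Z \<noteq> Up i \<and> compatible D (Up i) Z}" (is "_ = ?L")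
    proof (intro subset_antisym subsetI)
      fix Z assume "Z \<in> ?\<phi> ` ?J \<union> ?\<psi> ` ?K"
      then consider Y where "Y \<in> ?J" "Z = ?\<phi> Y" | Y where "Y \<in> ?K" "Z = ?\<psi> Y" by blast
      then show "Z \<in> ?L"
      proof cases
        case 1
        then show ?thesis using i by (cases Y) (auto simp: simps hE)
      next
        case 2
        then show ?thesis using i by (cases Y) (auto simp: simps hF)
      qed
    next
      fix Z assume "Z \<in> ?L"
      then have Z: "Z \<in> ?I" "Z \<noteq> Up i" "compatible D (Up i) Z" by auto
      show "Z \<in> ?\<phi> ` ?J \<union> ?\<psi> ` ?K"
      proof (cases Z)
        case (Up k)
        show ?thesis
        proof (cases "k < i")
          case True
          then have "Up k \<in> ?K" "Z = ?\<psi> (Up k)" using Z Up by auto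
          then show ?thesis by blast
        next
          case False
          then have "Up (k - i) \<in> ?J" "Z = ?\<phi> (Up (k - i))" using Z Up by auto
          then show ?thesis by blast
        qed
      next
        case (Down k)
        show ?thesis
        proof (cases "i < k")
          case True
          then have "Down (k - i) \<in> ?J" "Z = ?\<phi> (Down (k - i))" using Z Down by auto
          then show ?thesis by blast
        next
          case False
          then have "down_height D k < i" "k < i" 
            using Z Down i h[of k] by (auto simp: simps)
          then have "Down k \<in> ?K" "Z = ?\<psi> (Down k)" using Z Down by auto
          then show ?thesis by blast
        qed
      next
        case (Diamond a b)
        then consider "i < a" | "a < i" "b = i" | "b < i" using Z by fastforce
        then show ?thesis
        proof cases
          case 1
          then have "Diamond (a - i) (b - i) \<in> ?J" "Z = ?\<phi> (Diamond (a - i) (b - i))"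
            using Z Diamond by (auto simp: hE)
          then show ?thesis by blast
        next
          case 2
          then have "Down a \<in> ?K" "Z = ?\<psi> (Down a)" using Z Diamond by auto
          then show ?thesis by blast
        next
          case 3
          then have "Diamond a b \<in> ?K" "Z = ?\<psi> (Diamond a b)" using Z Diamond by (auto simp: hF)
          then show ?thesis by blast
        qed
      qed
    qed
    show "inj_on ?\<phi> ?J"
    proof (rule inj_onI)
      fix Y Z assume "?\<phi> Y = ?\<phi> Z"
      then show "Y = Z" by (cases Y; cases Z) auto
    qed
    show "inj_on ?\<psi> ?K"
    proof (rule inj_onI)
      fix Y Z assume "Y \<in> ?K" "Z \<in> ?K" "?\<psi> Y = ?\<psi> Z"
      then show "Y = Z" by (cases Y; cases Z) (auto split: if_splits)
    qed
  next
    fix Y Z assume "Y \<in> ?J" "Z \<in> ?J"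
    then show "compatible D (?\<phi> Y) (?\<phi> Z) \<longleftrightarrow> compatible ?E Y Z"
      using i by (cases Y; cases Z) (auto simp: simps hE)
  next
    fix Y Z assume "Y \<in> ?K" "Z \<in> ?K"
    then show "compatible D (?\<psi> Y) (?\<psi> Z) \<longleftrightarrow> compatible ?F Y Z"
      using i by (cases Y; cases Z) (auto simp: simps hF intro: order)
  next
    fix Y Z assume "Y \<in> ?J" "Z \<in> ?K"
    then show "?\<phi> Y \<noteq> ?\<psi> Z \<and> compatible D (?\<phi> Y) (?\<psi> Z)"
      using i by (cases Y; cases Z) (auto simp: simps)
  qed
qed

text \<open>Dual to the case of an up step: the left path keeps its labels unchanged, and in the right part diamonds
  starting in i stand in for the up steps before (\<open>\<Sigma>\<close>i).\<close>

lemma stratum_Down: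
  assumes X: "Down i \<in> index_set n D"
  shows "variety_iso (index_set n D) (config_stratum n D (Down i))
    (index_set (n - i) (path_right n D i) <+> index_set (i - 1) (path_left D i))
    (variety_prod (config_space (n - i) (path_right n D i)) (config_space (i - 1) (path_left D i)))"
proof -
  let ?\<phi> = "right_of_Down D i" and ?\<psi> = "\<lambda>Y::index. Y"
  let ?E = "path_right n D i" and ?F = "path_left D i"
  let ?I = "index_set n D" and ?J = "index_set (n - i) ?E" and ?K = "index_set (i - 1) ?F"
  have i: "1 \<le> i" "i \<le> n" using X by auto
  note E = path_right_heights(1)[OF D i] and F = path_left_heights(1)[OF D i]
  note hE = path_right_heights(2,3)[OF D i] and hF = path_left_heights(2,3)[OF D i]
  have h: "down_height D k \<ge> k" if "1 \<le> k" "k \<le> n" for k using D that by (simp add: dyck_path_iff)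
  have below: "down_height D k < a" if "down_height D i < a" "1 \<le> k" "k \<le> i" for k a
    using down_height_mono[OF D, of k i] that i by simp
  have above: "a \<le> down_height D k" if "a \<le> down_height D i" "i \<le> k" "k \<le> n" for k a
    using down_height_mono[OF D, of i k] that i by simp
  note simps = compat_simps compatible_Up_Down_iff[OF D] compatible_Up_Down_iff[OF E] compatible_Up_Down_iff[OF F]
  show ?thesis
  proof (rule stratum_iso_prodI[OF X])
    show "?\<phi> ` ?J \<union> ?\<psi> ` ?K = {Z \<in> ?I. Z \<noteq> Down i \<and> compatible D (Down i) Z}" (is "_ = ?L")
    proof (intro subset_antisym subsetI)
      fix Z assume "Z \<in> ?\<phi> ` ?J \<union> ?\<psi> ` ?K"
      then consider Y where "Y \<in> ?J" "Z = ?\<phi> Y" | "Z \<in> ?K" by blast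
      then show "Z \<in> ?L"
      proof cases
        case 1
        then show ?thesis using i by (cases Y) (auto simp: simps hE)
      next
        case 2
        then show ?thesis using i by (cases Z) (auto simp: simps hF)
      qed
    next
      fix Z assume "Z \<in> ?L"
      then have Z: "Z \<in> ?I" "Z \<noteq> Down i" "compatible D (Down i) Z" by auto
      show "Z \<in> ?\<phi> ` ?J \<union> ?\<psi> ` ?K"
      proof (cases Z)
        case (Up k)
        show ?thesis
        proof (cases "k < i")
          case True
          then show ?thesis using Z Up by auto
        next
          case False
          then have "down_height D i < k" using Z Up i by (auto simp: simps)
          then have "i < k" using h[of i] i by simp
          then have "Up (k - i) \<in> ?J" "Z = ?\<phi> (Up (k - i))"
            using Z Up \<open>down_height D i < k\<close> by auto
          then show ?thesis by blast
        qed
      next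
        case (Down k)
        show ?thesis
        proof (cases "k < i")
          case True
          then show ?thesis using Z Down by auto
        next
          case False
          then have "Down (k - i) \<in> ?J" "Z = ?\<phi> (Down (k - i))" using Z Down by auto
          then show ?thesis by blast
        qed
      next
        case (Diamond a b)
        then consider "i < a" | "a = i" | "b < i" using Z by fastforce
        then show ?thesis
        proof cases
          case 1
          then have "Diamond (a - i) (b - i) \<in> ?J" "Z = ?\<phi> (Diamond (a - i) (b - i))"
            using Z Diamond by (auto simp: hE)
          then show ?thesis by blast
        next
          case 2
          then have "Up (b - i) \<in> ?J" "Z = ?\<phi> (Up (b - i))" using Z Diamond by auto
          then show ?thesis by blast
        next
          case 3
          then show ?thesis using Z Diamond by (auto simp: hF)
        qed
      qed
    qed
    show "inj_on ?\<phi> ?J"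
    proof (rule inj_onI)
      fix Y Z assume "Y \<in> ?J" "Z \<in> ?J" "?\<phi> Y = ?\<phi> Z"
      then show "Y = Z" by (cases Y; cases Z) (auto split: if_splits)
    qed
    show "inj_on ?\<psi> ?K" by simp
  next
    fix Y Z assume "Y \<in> ?J" "Z \<in> ?J"
    then show "compatible D (?\<phi> Y) (?\<phi> Z) \<longleftrightarrow> compatible ?E Y Z"
      using i by (cases Y; cases Z) (auto simp: simps hE not_less above leD[OF above])
  next
    fix Y Z assume "Y \<in> ?K" "Z \<in> ?K"
    then show "compatible D (?\<psi> Y) (?\<psi> Z) \<longleftrightarrow> compatible ?F Y Z"
      using i by (cases Y; cases Z) (auto simp: simps hF)
  next
    fix Y Z assume "Y \<in> ?J" "Z \<in> ?K"
    then show "?\<phi> Y \<noteq> ?\<psi> Z \<and> compatible D (?\<phi> Y) (?\<psi> Z)"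
      using i by (cases Y; cases Z) (auto simp: simps below)
  qed
qed

end


theorem proposition3p8:
  fixes n :: nat and D :: "step list" and X :: index
  assumes "dyck_path n D" and "X \<in> index_set n D"
  shows "\<exists>m' D' m'' D''.
    dyck_path m' D' \<and> m' < n \<and> dyck_path m'' D'' \<and> m'' < n \<and>
    variety_iso
      (index_set n D) (config_stratum n D X)
      (index_set m' D' <+> index_set m'' D'')
      (variety_prod (config_space m' D') (config_space m'' D'')) \<and>
    (\<forall>i j. X = Diamond i j \<longrightarrow>
       m' = j - i - 1 \<and> D' = full_path (j - i - 1) \<and>
       m'' = n + i - j \<and> D'' = path_diamond D i j) \<and>
    (\<forall>i. X = Up i \<or> X = Down i \<longrightarrow>
       m' = n - i \<and> D' = path_right n D i \<and>
       m'' = i - 1 \<and> D'' = path_left D i)"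
proof (cases X)
  case (Up i)
  then have i: "1 \<le> i" "i \<le> n" using assms(2) by auto
  show ?thesis
    using Up i assms stratum_Up path_right_heights(1) path_left_heights(1)
    by (intro exI[of _ "n - i"] exI[of _ "path_right n D i"] exI[of _ "i - 1"] exI[of _ "path_left D i"]) auto
next
  case (Down i)
  then have i: "1 \<le> i" "i \<le> n" using assms(2) by auto
  show ?thesis
    using Down i assms stratum_Down path_right_heights(1) path_left_heights(1)
    by (intro exI[of _ "n - i"] exI[of _ "path_right n D i"] exI[of _ "i - 1"] exI[of _ "path_left D i"]) auto
next
  case (Diamond i j)
  then have ij: "1 \<le> i" "i < j" "j \<le> n" "j \<le> down_height D i" using assms(2) by auto
  show ?thesis
    using Diamond ij assms stratum_Diamond path_diamond_heights(1)[OF assms(1) ij] dyck_path_full_path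
    by (intro exI[of _ "j - i - 1"] exI[of _ "full_path (j - i - 1)"] exI[of _ "n + i - j"]
        exI[of _ "path_diamond D i j"]) auto
qed

end
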